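(* Let $\mathcal{M}_0(\lambda,\mu,\nu)$ be the space of $\mathrm{SU}(3)$-conjugacy classes of Higgs fields $$\Phi(z)=\left(\frac{X}{z}+\frac{Y}{z-1}+\frac{Z}{z+1}\right)dz,\qquad X+Y+Z=0,$$ on the trivial $\mathrm{SU}(3)$-bundle over $\mathbb{P}^1$, with residues $X\in\mathcal{O}_{i\lambda}$, $Y\in\mathcal{O}_{i\mu}$, $Z\in\mathcal{O}_{i\nu}$ at $0,1,-1$ respectively. Then taking residues, $[\Phi]\mapsto[(X,Y,Z)]$, gives an identification $$\mathcal{M}_0(\lambda,\mu,\nu)\;\cong\;\mathbb{P}(\lambda,\mu,\nu)$$ as symplectic manifolds.
   Context: $\lambda,\mu,\nu$ are real diagonal traceless $3\times3$ matrices, so $i\lambda,i\mu,i\nu\in\mathfrak{su}(3)$, and $\mathcal{O}_{i\lambda},\mathcal{O}_{i\mu},\mathcal{O}_{i\nu}\subset\mathfrak{su}(3)$ are their adjoint orbits, identified with coadjoint orbits by an invariant inner product and carrying their Kirillov–Kostant–Souriau symplectic forms. The triple reduced product is the symplectic quotient $\mathbb{P}(\lambda,\mu,\nu)=(\mathcal{O}_{i\lambda}\times\mathcal{O}_{i\mu}\times\mathcal{O}_{i\nu})/\!/\mathrm{SU}(3)=M^{-1}(0)/\mathrm{SU}(3)$, where $\mathrm{SU}(3)$ acts diagonally by the adjoint action with moment map $M(X,Y,Z)=X+Y+Z$. It is assumed that the parameters are such that this quotient is a symplectic manifold. $\mathrm{SU}(3)$ acts on Higgs fields $\Phi$ by conjugation.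 The symplectic structure on $\mathcal{M}_0(\lambda,\mu,\nu)$ is the one obtained by symplectic reduction, for this conjugation action, of the space of triples of residues, with its product Kirillov–Kostant–Souriau form. *)

theory Defs
  imports "HOL-Analysis.Analysis" "HOL-Complex_Analysis.Complex_Analysis"
begin

section \<open>Smooth maps and symplectic manifolds\<close>

primrec Ck_on ::
  "nat \<Rightarrow> ('a::real_normed_vector \<Rightarrow> 'b::real_normed_vector) \<Rightarrow> 'a set \<Rightarrow> bool" where
  "Ck_on 0 f U = continuous_on U f"
| "Ck_on (Suc k) f U =
     ((\<forall>x\<in>U. f differentiable (at x)) \<and> (\<forall>v. Ck_on k (\<lambda>x. frechet_derivative f (at x) v) U))"

text \<open>Smoothness on an arbitrary subset of a Euclidean space: local extendability to a smooth map
  on an open set.  On open sets this is the usual notion; on embedded submanifolds it is the notion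
  of smoothness of the submanifold.\<close>

definition smooth_on ::
  "'a::euclidean_space set \<Rightarrow> ('a \<Rightarrow> 'b::real_normed_vector) \<Rightarrow> bool" where
  "smooth_on S f \<longleftrightarrow>
     (\<forall>x\<in>S. \<exists>U g. open U \<and> x \<in> U \<and> (\<forall>k. Ck_on k g U) \<and> (\<forall>y\<in>S \<inter> U. g y = f y))"

definition dir_deriv :: "('a::real_vector \<Rightarrow> 'b::real_normed_vector) \<Rightarrow> 'a \<Rightarrow> 'a \<Rightarrow> 'b" where
  "dir_deriv f x v = vector_derivative (\<lambda>t::real. f (x + t *\<^sub>R v)) (at 0)"

text \<open>A chart is a pair \<open>(U, \<phi>)\<close>; only the values of \<open>\<phi>\<close> on \<open>U\<close> matter.  All charts take values in
  a linear subspace \<open>E\<close> of the Euclidean space \<open>'e\<close>, so that every dimension, \<open>0\<close> included, is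
  covered.  A 2-form is given by its local representatives: \<open>two_form M c x u v\<close> is its value at \<open>x\<close>
  on the tangent vectors with coordinates \<open>u, v \<in> E\<close> in the chart \<open>c\<close>.\<close>

type_synonym ('b, 'e) chart = "'b set \<times> ('b \<Rightarrow> 'e)"

record ('b, 'e) form_manifold =
  base :: "'b topology"
  charts :: "('b, 'e) chart set"
  two_form :: "('b, 'e) chart \<Rightarrow> 'b \<Rightarrow> 'e \<Rightarrow> 'e \<Rightarrow> real"

definition is_chart :: "'e::euclidean_space set \<Rightarrow> 'b topology \<Rightarrow> ('b, 'e) chart \<Rightarrow> bool" where
  "is_chart E T c \<longleftrightarrow>
     (case c of (U, \<phi>) \<Rightarrow> openin T U \<and> openin (top_of_set E) (\<phi> ` U) \<and>
        homeomorphic_map (subtopology T U) (top_of_set (\<phi> ` U)) \<phi>)"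

text \<open>The local expression of a map \<open>F\<close> in charts \<open>c\<close>, \<open>c'\<close>, and its domain.\<close>

definition local_dom :: "('b, 'e) chart \<Rightarrow> ('b \<Rightarrow> 'c) \<Rightarrow> ('c, 'f) chart \<Rightarrow> 'e set" where
  "local_dom c F c' = (case (c, c') of ((U, \<phi>), (U', \<psi>)) \<Rightarrow> \<phi> ` {x \<in> U. F x \<in> U'})"

definition local_map :: "('b, 'e) chart \<Rightarrow> ('b \<Rightarrow> 'c) \<Rightarrow> ('c, 'f) chart \<Rightarrow> 'e \<Rightarrow> 'f" where
  "local_map c F c' = (case (c, c') of ((U, \<phi>), (U', \<psi>)) \<Rightarrow> (\<lambda>y. \<psi> (F (inv_into U \<phi> y))))"

definition smooth_manifold ::
  "'e::euclidean_space set \<Rightarrow> ('b, 'e, 'z) form_manifold_scheme \<Rightarrow> bool" where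
  "smooth_manifold E M \<longleftrightarrow>
     subspace E \<and> Hausdorff_space (base M) \<and> second_countable (base M) \<and>
     (\<forall>c\<in>charts M. is_chart E (base M) c) \<and>
     (\<Union>c\<in>charts M. fst c) = topspace (base M) \<and>
     (\<forall>c\<in>charts M. \<forall>c'\<in>charts M. smooth_on (local_dom c id c') (local_map c id c'))"

definition symplectic_manifold ::
  "'e::euclidean_space set \<Rightarrow> ('b, 'e, 'z) form_manifold_scheme \<Rightarrow> bool" where
  "symplectic_manifold E M \<longleftrightarrow>
     smooth_manifold E M \<and>
     \<comment> \<open>the local representatives define a 2-form\<close>
     (\<forall>c\<in>charts M. \<forall>x\<in>fst c. \<forall>u\<in>E. \<forall>v\<in>E.
        two_form M c x u v = - two_form M c x v u \<and>
        (\<forall>w\<in>E. two_form M c x (u + w) v = two_form M c x u v + two_form M c x w v) \<and>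
        (\<forall>a. two_form M c x (a *\<^sub>R u) v = a * two_form M c x u v)) \<and>
     (\<forall>c\<in>charts M. \<forall>c'\<in>charts M. \<forall>x\<in>fst c \<inter> fst c'. \<forall>u\<in>E. \<forall>v\<in>E.
        two_form M c x u v =
          two_form M c' x (dir_deriv (local_map c id c') (snd c x) u)
                          (dir_deriv (local_map c id c') (snd c x) v)) \<and>
     \<comment> \<open>smooth\<close>
     (\<forall>c\<in>charts M. \<forall>u\<in>E. \<forall>v\<in>E.
        smooth_on (snd c ` fst c) (\<lambda>y. two_form M c (inv_into (fst c) (snd c) y) u v)) \<and>
     \<comment> \<open>nondegenerate\<close>
     (\<forall>c\<in>charts M. \<forall>x\<in>fst c. \<forall>u\<in>E. (\<forall>v\<in>E. two_form M c x u v = 0) \<longrightarrow> u = 0) \<and>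
     \<comment> \<open>closed\<close>
     (\<forall>c\<in>charts M. \<forall>x\<in>fst c. \<forall>u\<in>E. \<forall>v\<in>E. \<forall>w\<in>E.
        (let \<Omega> = (\<lambda>u v y. two_form M c (inv_into (fst c) (snd c) y) u v); y = snd c x
         in dir_deriv (\<Omega> v w) y u + dir_deriv (\<Omega> w u) y v + dir_deriv (\<Omega> u v) y w = 0))"

definition smooth_map ::
  "('b, 'e::euclidean_space, 'y) form_manifold_scheme \<Rightarrow>
   ('c, 'f::euclidean_space, 'z) form_manifold_scheme \<Rightarrow> ('b \<Rightarrow> 'c) \<Rightarrow> bool" where
  "smooth_map M N F \<longleftrightarrow>
     continuous_map (base M) (base N) F \<and>
     (\<forall>c\<in>charts M. \<forall>c'\<in>charts N. smooth_on (local_dom c F c') (local_map c F c'))"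

definition symplectomorphism ::
  "'e::euclidean_space set \<Rightarrow> ('b, 'e, 'y) form_manifold_scheme \<Rightarrow>
   ('c, 'e, 'z) form_manifold_scheme \<Rightarrow> ('b \<Rightarrow> 'c) \<Rightarrow> bool" where
  "symplectomorphism E M N F \<longleftrightarrow>
     bij_betw F (topspace (base M)) (topspace (base N)) \<and>
     smooth_map M N F \<and>
     smooth_map N M (inv_into (topspace (base M)) F) \<and>
     (\<forall>c\<in>charts M. \<forall>c'\<in>charts N. \<forall>x\<in>fst c. F x \<in> fst c' \<longrightarrow> (\<forall>u\<in>E. \<forall>v\<in>E.
        two_form M c x u v =
          two_form N c' (F x) (dir_deriv (local_map c F c') (snd c x) u)
                              (dir_deriv (local_map c F c') (snd c x) v)))"


section \<open>SU(3), its Lie algebra and adjoint orbits\<close>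

type_synonym mat3 = "complex^3^3"

definition ctranspose :: "mat3 \<Rightarrow> mat3" where
  "ctranspose A = (\<chi> i j. cnj (A $ j $ i))"

definition SU3 :: "mat3 set" where
  "SU3 = {g. g ** ctranspose g = mat 1 \<and> ctranspose g ** g = mat 1 \<and> det g = 1}"

definition su3 :: "mat3 set" where
  "su3 = {A. ctranspose A = - A \<and> trace A = 0}"

definition Ad :: "mat3 \<Rightarrow> mat3 \<Rightarrow> mat3" where
  "Ad g A = g ** A ** matrix_inv g"

definition lie_bracket :: "mat3 \<Rightarrow> mat3 \<Rightarrow> mat3" where
  "lie_bracket A B = A ** B - B ** A"

definition diagonal_traceless :: "real^3^3 \<Rightarrow> bool" where
  "diagonal_traceless A \<longleftrightarrow> (\<forall>i j. i \<noteq> j \<longrightarrow> A $ i $ j = 0) \<and> trace A = 0"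

definition imat :: "real^3^3 \<Rightarrow> mat3" where
  "imat A = (\<chi> i j. \<i> * complex_of_real (A $ i $ j))"

definition adj_orbit :: "mat3 \<Rightarrow> mat3 set" where
  "adj_orbit X = (\<lambda>g. Ad g X) ` SU3"

definition invariant_inner_product :: "(mat3 \<Rightarrow> mat3 \<Rightarrow> real) \<Rightarrow> bool" where
  "invariant_inner_product ip \<longleftrightarrow>
     (\<forall>A\<in>su3. \<forall>B\<in>su3. ip A B = ip B A \<and>
        (\<forall>C\<in>su3. ip (A + B) C = ip A C + ip B C) \<and>
        (\<forall>a. ip (a *\<^sub>R A) B = a * ip A B) \<and>
        (\<forall>g\<in>SU3. ip (Ad g A) (Ad g B) = ip A B)) \<and>
     (\<forall>A\<in>su3. A \<noteq> 0 \<longrightarrow> ip A A > 0)"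

text \<open>The Kirillov--Kostant--Souriau form at \<open>X\<close>.  Tangent vectors to the orbit of \<open>X\<close> are the
  matrices \<open>[A, X]\<close>, \<open>A \<in> su(3)\<close>, and \<open>\<omega>\<^sub>X([A,X], [B,X]) = \<langle>X, [A,B]\<rangle>\<close>.\<close>

definition kks :: "(mat3 \<Rightarrow> mat3 \<Rightarrow> real) \<Rightarrow> mat3 \<Rightarrow> mat3 \<Rightarrow> mat3 \<Rightarrow> real" where
  "kks ip X u v =
     (THE r. \<exists>A\<in>su3. \<exists>B\<in>su3. u = lie_bracket A X \<and> v = lie_bracket B X \<and>
        r = ip X (lie_bracket A B))"


section \<open>Symplectic reduction by SU(3)\<close>

text \<open>A Hamiltonian SU(3)-space whose manifold structure is that of the embedded submanifold
  \<open>coord ` points\<close> of the Euclidean space \<open>'w\<close>, \<open>coord\<close> being injective on \<open>points\<close>; tangent vectors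
  at \<open>p\<close> are elements of \<open>'w\<close>, and \<open>omega p\<close> is the symplectic form on them.\<close>

record ('a, 'w) ham_space =
  points :: "'a set"
  coord :: "'a \<Rightarrow> 'w"
  act :: "mat3 \<Rightarrow> 'a \<Rightarrow> 'a"
  omega :: "'a \<Rightarrow> 'w \<Rightarrow> 'w \<Rightarrow> real"
  moment :: "'a \<Rightarrow> mat3"

definition zero_level :: "('a, 'w, 'z) ham_space_scheme \<Rightarrow> 'a set" where
  "zero_level H = {p \<in> points H. moment H p = 0}"

definition orbit_of :: "('a, 'w, 'z) ham_space_scheme \<Rightarrow> 'a \<Rightarrow> 'a set" where
  "orbit_of H p = (\<lambda>g. act H g p) ` SU3"

text \<open>Quotient topology on the set of orbits in the zero level.\<close>

definition quotient_topology ::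
  "('a, 'w::euclidean_space, 'z) ham_space_scheme \<Rightarrow> 'a set topology" where
  "quotient_topology H = topology (\<lambda>V. V \<subseteq> orbit_of H ` zero_level H \<and>
     openin (pullback_topology (zero_level H) (coord H) euclidean)
            {p \<in> zero_level H. orbit_of H p \<in> V})"

lemma openin_quotient_topology:
  fixes H :: "('a, 'w::euclidean_space, 'z) ham_space_scheme"
  shows "openin (quotient_topology H) V \<longleftrightarrow> V \<subseteq> orbit_of H ` zero_level H \<and>
     openin (pullback_topology (zero_level H) (coord H) euclidean)
            {p \<in> zero_level H. orbit_of H p \<in> V}"
proof -
  let ?Z = "zero_level H" and ?T = "pullback_topology (zero_level H) (coord H) euclidean"
  have "istopology (\<lambda>V. V \<subseteq> orbit_of H ` ?Z \<and> openin ?T {p \<in> ?Z. orbit_of H p \<in> V})"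
    unfolding istopology_def
  proof (intro conjI allI impI)
    fix S T
    assume "S \<subseteq> orbit_of H ` ?Z \<and> openin ?T {p \<in> ?Z. orbit_of H p \<in> S}"
      and "T \<subseteq> orbit_of H ` ?Z \<and> openin ?T {p \<in> ?Z. orbit_of H p \<in> T}"
    moreover have "{p \<in> ?Z. orbit_of H p \<in> S \<inter> T} =
        {p \<in> ?Z. orbit_of H p \<in> S} \<inter> {p \<in> ?Z. orbit_of H p \<in> T}" by auto
    ultimately show "S \<inter> T \<subseteq> orbit_of H ` ?Z"
      and "openin ?T {p \<in> ?Z. orbit_of H p \<in> S \<inter> T}"
      by (auto simp del: Int_iff)
  next
    fix K assume K: "\<forall>S\<in>K. S \<subseteq> orbit_of H ` ?Z \<and> openin ?T {p \<in> ?Z. orbit_of H p \<in> S}"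
    then show "\<Union>K \<subseteq> orbit_of H ` ?Z" by blast
    have "{p \<in> ?Z. orbit_of H p \<in> \<Union>K} = (\<Union>S\<in>K. {p \<in> ?Z. orbit_of H p \<in> S})" by auto
    with K show "openin ?T {p \<in> ?Z. orbit_of H p \<in> \<Union>K}" by auto
  qed
  then show ?thesis
    by (simp add: quotient_topology_def topology_inverse')
qed

lemma topspace_quotient_topology:
  fixes H :: "('a, 'w::euclidean_space, 'z) ham_space_scheme"
  shows "topspace (quotient_topology H) = orbit_of H ` zero_level H"
proof -
  have "{p \<in> zero_level H. orbit_of H p \<in> orbit_of H ` zero_level H} = zero_level H"
    by auto
  moreover have "openin (pullback_topology (zero_level H) (coord H) euclidean) (zero_level H)"
    by (metis Int_absorb1 openin_topspace topspace_euclidean topspace_pullback_topology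
        inf_commute inf_top_left vimage_UNIV)
  ultimately have "openin (quotient_topology H) (orbit_of H ` zero_level H)"
    by (simp add: openin_quotient_topology)
  then show ?thesis
    by (metis openin_quotient_topology openin_subset openin_topspace subset_antisym)
qed

text \<open>The quotient smooth structure, for which the projection \<open>\<pi>\<close> from the zero level is a submersion:
  \<open>(U, \<phi>)\<close> is a chart iff it is a topological chart such that \<open>\<phi> \<circ> \<pi>\<close> is smooth and has a smooth local
  section through every point (which for smooth maps between manifolds means being a submersion).\<close>

definition quotient_charts ::
  "'e::euclidean_space set \<Rightarrow> ('a, 'w::euclidean_space, 'z) ham_space_scheme \<Rightarrow>
   ('a set, 'e) chart set" where
  "quotient_charts E H = {(U, \<phi>). is_chart E (quotient_topology H) (U, \<phi>) \<and>
     (let N = {p \<in> zero_level H. orbit_of H p \<in> U}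
      in smooth_on (coord H ` N) (\<lambda>w. \<phi> (orbit_of H (inv_into N (coord H) w))) \<and>
         (\<forall>p\<in>N. \<exists>V s. openin (top_of_set E) V \<and> \<phi> (orbit_of H p) \<in> V \<and>
            s ` V \<subseteq> N \<and> smooth_on V (\<lambda>y. coord H (s y)) \<and>
            s (\<phi> (orbit_of H p)) = p \<and> (\<forall>y\<in>V. \<phi> (orbit_of H (s y)) = y)))}"

text \<open>Germs at time \<open>0\<close> of smooth curves in the zero level; their velocities are the tangent
  vectors of the zero level.\<close>

definition curve_at ::
  "('a, 'w::euclidean_space, 'z) ham_space_scheme \<Rightarrow> 'a \<Rightarrow> (real \<Rightarrow> 'a) \<Rightarrow> bool" where
  "curve_at H p \<gamma> \<longleftrightarrow> \<gamma> 0 = p \<and>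
     (\<exists>\<epsilon>>0. \<gamma> ` {-\<epsilon><..<\<epsilon>} \<subseteq> zero_level H \<and> smooth_on {-\<epsilon><..<\<epsilon>} (\<lambda>t. coord H (\<gamma> t)))"

definition velocity ::
  "('a, 'w::euclidean_space, 'z) ham_space_scheme \<Rightarrow> (real \<Rightarrow> 'a) \<Rightarrow> 'w" where
  "velocity H \<gamma> = vector_derivative (\<lambda>t. coord H (\<gamma> t)) (at 0)"

definition projected_velocity ::
  "('a, 'w::euclidean_space, 'z) ham_space_scheme \<Rightarrow> ('a set, 'e::euclidean_space) chart \<Rightarrow>
   (real \<Rightarrow> 'a) \<Rightarrow> 'e" where
  "projected_velocity H c \<gamma> = vector_derivative (\<lambda>t. snd c (orbit_of H (\<gamma> t))) (at 0)"

text \<open>The reduced form \<open>\<omega>\<^sub>r\<^sub>e\<^sub>d\<close>, characterised by \<open>\<pi>\<^sup>* \<omega>\<^sub>r\<^sub>e\<^sub>d = \<iota>\<^sup>* \<omega>\<close> on the zero level.\<close>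

definition reduced_form ::
  "('a, 'w::euclidean_space, 'z) ham_space_scheme \<Rightarrow> ('a set, 'e::euclidean_space) chart \<Rightarrow>
   'a set \<Rightarrow> 'e \<Rightarrow> 'e \<Rightarrow> real" where
  "reduced_form H c x u v =
     (THE r. \<exists>p \<gamma> \<delta>. p \<in> zero_level H \<and> orbit_of H p = x \<and> curve_at H p \<gamma> \<and> curve_at H p \<delta> \<and>
        projected_velocity H c \<gamma> = u \<and> projected_velocity H c \<delta> = v \<and>
        r = omega H p (velocity H \<gamma>) (velocity H \<delta>))"

definition symplectic_quotient ::
  "'e::euclidean_space set \<Rightarrow> ('a, 'w::euclidean_space, 'z) ham_space_scheme \<Rightarrow>
   ('a set, 'e) form_manifold" where
  "symplectic_quotient E H =
     \<lparr>base = quotient_topology H, charts = quotient_charts E H, two_form = reduced_form H\<rparr>"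

text \<open>The symplectic quotient is a symplectic manifold of dimension \<open>dim E\<close>, with
  \<open>\<pi>\<^sup>* \<omega>\<^sub>r\<^sub>e\<^sub>d = \<iota>\<^sup>* \<omega>\<close>.\<close>

definition quotient_is_symplectic_manifold ::
  "'e::euclidean_space set \<Rightarrow> ('a, 'w::euclidean_space, 'z) ham_space_scheme \<Rightarrow> bool" where
  "quotient_is_symplectic_manifold E H \<longleftrightarrow>
     symplectic_manifold E (symplectic_quotient E H) \<and>
     (\<forall>c\<in>quotient_charts E H. \<forall>p\<in>zero_level H. orbit_of H p \<in> fst c \<longrightarrow>
        (\<forall>\<gamma> \<delta>. curve_at H p \<gamma> \<and> curve_at H p \<delta> \<longrightarrow>
           reduced_form H c (orbit_of H p) (projected_velocity H c \<gamma>) (projected_velocity H c \<delta>) =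
           omega H p (velocity H \<gamma>) (velocity H \<delta>)))"


section \<open>Triples and Higgs fields\<close>

type_synonym triple = "mat3 \<times> mat3 \<times> mat3"

definition orbit_product :: "real^3^3 \<Rightarrow> real^3^3 \<Rightarrow> real^3^3 \<Rightarrow> triple set" where
  "orbit_product lam mu nu = adj_orbit (imat lam) \<times> adj_orbit (imat mu) \<times> adj_orbit (imat nu)"

definition Ad_triple :: "mat3 \<Rightarrow> triple \<Rightarrow> triple" where
  "Ad_triple g = (\<lambda>(X, Y, Z). (Ad g X, Ad g Y, Ad g Z))"

definition kks_triple :: "(mat3 \<Rightarrow> mat3 \<Rightarrow> real) \<Rightarrow> triple \<Rightarrow> triple \<Rightarrow> triple \<Rightarrow> real" where
  "kks_triple ip = (\<lambda>(X, Y, Z) (u1, u2, u3) (v1, v2, v3).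
     kks ip X u1 v1 + kks ip Y u2 v2 + kks ip Z u3 v3)"

definition sum_triple :: "triple \<Rightarrow> mat3" where
  "sum_triple = (\<lambda>(X, Y, Z). X + Y + Z)"

definition triple_space ::
  "(mat3 \<Rightarrow> mat3 \<Rightarrow> real) \<Rightarrow> real^3^3 \<Rightarrow> real^3^3 \<Rightarrow> real^3^3 \<Rightarrow> (triple, triple) ham_space" where
  "triple_space ip lam mu nu =
     \<lparr>points = orbit_product lam mu nu, coord = id, act = Ad_triple,
      omega = kks_triple ip, moment = sum_triple\<rparr>"

definition triple_reduced_product ::
  "'e::euclidean_space set \<Rightarrow> (mat3 \<Rightarrow> mat3 \<Rightarrow> real) \<Rightarrow> real^3^3 \<Rightarrow> real^3^3 \<Rightarrow> real^3^3 \<Rightarrow>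
   (triple set, 'e) form_manifold" where
  "triple_reduced_product E ip lam mu nu = symplectic_quotient E (triple_space ip lam mu nu)"

text \<open>A Higgs field \<open>\<Phi>(z) = F(z) dz\<close> on the trivial bundle is represented by its coefficient
  \<open>F\<close> in the affine coordinate \<open>z\<close>; the values of \<open>F\<close> at the poles \<open>0, 1, -1\<close> are irrelevant.  When
  \<open>X + Y + Z = 0\<close> the form has no pole at infinity.\<close>

type_synonym higgs = "complex \<Rightarrow> mat3"

definition higgs_field :: "triple \<Rightarrow> higgs" where
  "higgs_field = (\<lambda>(X, Y, Z) z. \<chi> i j. X $ i $ j / z + Y $ i $ j / (z - 1) + Z $ i $ j / (z + 1))"

definition matrix_residue :: "higgs \<Rightarrow> complex \<Rightarrow> mat3" where
  "matrix_residue \<Phi> a = (\<chi> i j. residue (\<lambda>z. \<Phi> z $ i $ j) a)"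

definition residues :: "higgs \<Rightarrow> triple" where
  "residues \<Phi> = (matrix_residue \<Phi> 0, matrix_residue \<Phi> 1, matrix_residue \<Phi> (-1))"

text \<open>Such fields form a finite-dimensional vector space on which \<open>residues\<close> are linear coordinates.
  The symplectic form and the moment map are those of the space of triples of residues; the condition
  \<open>X + Y + Z = 0\<close> is the vanishing of the moment map.\<close>

definition higgs_space ::
  "(mat3 \<Rightarrow> mat3 \<Rightarrow> real) \<Rightarrow> real^3^3 \<Rightarrow> real^3^3 \<Rightarrow> real^3^3 \<Rightarrow> (higgs, triple) ham_space" where
  "higgs_space ip lam mu nu =
     \<lparr>points = higgs_field ` orbit_product lam mu nu, coord = residues,
      act = (\<lambda>g \<Phi> z. Ad g (\<Phi> z)),
      omega = (\<lambda>\<Phi>. kks_triple ip (residues \<Phi>)),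
      moment = (\<lambda>\<Phi>. sum_triple (residues \<Phi>))\<rparr>"

definition higgs_moduli ::
  "'e::euclidean_space set \<Rightarrow> (mat3 \<Rightarrow> mat3 \<Rightarrow> real) \<Rightarrow> real^3^3 \<Rightarrow> real^3^3 \<Rightarrow> real^3^3 \<Rightarrow>
   (higgs set, 'e) form_manifold" where
  "higgs_moduli E ip lam mu nu = symplectic_quotient E (higgs_space ip lam mu nu)"

definition conj_class :: "higgs \<Rightarrow> higgs set" where
  "conj_class \<Phi> = (\<lambda>g z. Ad g (\<Phi> z)) ` SU3"

definition triple_class :: "triple \<Rightarrow> triple set" where
  "triple_class t = (\<lambda>g. Ad_triple g t) ` SU3"

definition residue_map :: "higgs set \<Rightarrow> triple set" where
  "residue_map C = residues ` C"

lemma residue_three_poles: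
  fixes a b c :: complex
  defines "f \<equiv> \<lambda>z. a / z + b / (z - 1) + c / (z + 1)"
  shows "residue f 0 = a" "residue f 1 = b" "residue f (-1) = c"
proof -
  have "((\<lambda>w. a + (b / (w - 1) + c / (w + 1)) * w) \<longlongrightarrow> a + (b / (0 - 1) + c / (0 + 1)) * 0) (at 0)"
    by (intro tendsto_intros) auto
  moreover have "\<forall>\<^sub>F w in at 0. a + (b / (w - 1) + c / (w + 1)) * w = f w * (w - 0)"
    by (auto simp: f_def eventually_at field_simps intro!: exI[of _ 1])
  ultimately have "((\<lambda>w. f w * (w - 0)) \<longlongrightarrow> a) (at 0)"
    using tendsto_cong by (fastforce elim: Lim_transform_eventually)
  then show "residue f 0 = a"
    by (intro residue_simple'[of "-{1,-1}"])
       (auto simp: f_def eq_neg_iff_add_eq_0 open_Compl intro!: holomorphic_intros)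
  have "((\<lambda>w. b + (a / w + c / (w + 1)) * (w - 1)) \<longlongrightarrow> b + (a / 1 + c / (1 + 1)) * (1 - 1)) (at 1)"
    by (intro tendsto_intros) auto
  moreover have "\<forall>\<^sub>F w in at 1. b + (a / w + c / (w + 1)) * (w - 1) = f w * (w - 1)"
    by (auto simp: f_def eventually_at field_simps intro!: exI[of _ 1])
  ultimately have "((\<lambda>w. f w * (w - 1)) \<longlongrightarrow> b) (at 1)"
    by (fastforce elim: Lim_transform_eventually)
  then show "residue f 1 = b"
    by (intro residue_simple'[of "-{0,-1}"])
       (auto simp: f_def eq_neg_iff_add_eq_0 open_Compl intro!: holomorphic_intros)
  have "((\<lambda>w. c + (a / w + b / (w - 1)) * (w + 1)) \<longlongrightarrow>
      c + (a / (-1) + b / (-1 - 1)) * (-1 + 1)) (at (-1))"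
    by (intro tendsto_intros) auto
  moreover have "\<forall>\<^sub>F w in at (-1). c + (a / w + b / (w - 1)) * (w + 1) = f w * (w - (-1))"
    by (auto simp: f_def eventually_at divide_simps eq_neg_iff_add_eq_0 intro!: exI[of _ 1])
  ultimately have "((\<lambda>w. f w * (w - (-1))) \<longlongrightarrow> c) (at (-1))"
    by (fastforce elim: Lim_transform_eventually)
  then show "residue f (-1) = c"
    by (intro residue_simple'[of "-{0,1}"])
       (auto simp: f_def eq_neg_iff_add_eq_0 open_Compl intro!: holomorphic_intros)
qed

lemma residues_higgs_field: "residues (higgs_field t) = t"
  by (cases t) (simp add: residues_def matrix_residue_def higgs_field_def residue_three_poles)

lemma topspace_higgs_moduli:
  "topspace (base (higgs_moduli E ip lam mu nu)) =
     {conj_class (higgs_field (X, Y, Z)) | X Y Z.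
        X \<in> adj_orbit (imat lam) \<and> Y \<in> adj_orbit (imat mu) \<and> Z \<in> adj_orbit (imat nu) \<and>
        X + Y + Z = 0}"
  by (force simp: higgs_moduli_def symplectic_quotient_def topspace_quotient_topology
      zero_level_def orbit_of_def higgs_space_def conj_class_def orbit_product_def
      residues_higgs_field sum_triple_def)

lemma topspace_triple_reduced_product:
  "topspace (base (triple_reduced_product E ip lam mu nu)) =
     {triple_class (X, Y, Z) | X Y Z.
        X \<in> adj_orbit (imat lam) \<and> Y \<in> adj_orbit (imat mu) \<and> Z \<in> adj_orbit (imat nu) \<and>
        X + Y + Z = 0}"
  by (force simp: triple_reduced_product_def symplectic_quotient_def topspace_quotient_topology
      zero_level_def orbit_of_def triple_space_def triple_class_def orbit_product_def
      sum_triple_def)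

end

theory Submission
  imports Defs
begin

text \<open>Higgs fields with simple poles at \<open>0, 1, -1\<close> and triples of residues determine each other, and
  this correspondence intertwines the conjugation actions, the moment maps, the coordinates and the
  symplectic forms.  Symplectic reduction is natural for such isomorphisms of Hamiltonian spaces, so
  charts, smoothness and the reduced form are carried over from one quotient to the other.\<close>

section \<open>Smooth functions and directional derivatives\<close>

text \<open>The two quotients have points of different types, so their structures cannot simply be
  equated; they meet only through charts, \<open>inv_into\<close>, directional derivatives and
  definite descriptions, all of which have arbitrary values off their domains. What makes the
  comparison cheap is that the coordinate of a Higgs field is its triple of residues: the
  isomorphism is the identity on the ambient Euclidean space. Every differential condition then
  concerns two functions that agree on the relevant set, so congruence rules suffice and no chain
  rule is needed. Only the triple side is assumed to be symplectic; for the Higgs side this has to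
  be derived.\<close>

lemma smooth_on_cong:
  assumes "smooth_on S f" "S = T" "\<And>x. x \<in> S \<Longrightarrow> f x = g x"
  shows "smooth_on T g"
  using assms unfolding smooth_on_def by (metis IntE)

text \<open>Agreement is known only on a set open in \<open>E\<close>, not on a neighbourhood in the
  whole space. As \<open>v\<close> lies in \<open>E\<close>, the line through \<open>y\<close> in
  direction \<open>v\<close> stays in \<open>E\<close>, hence in \<open>S\<close> for small
  \<open>t\<close>.\<close>

lemma dir_deriv_cong:
  fixes y :: "'a::real_normed_vector"
  assumes "subspace E" "openin (top_of_set E) S" "y \<in> S" "v \<in> E" "\<And>z. z \<in> S \<Longrightarrow> f z = g z"
  shows "dir_deriv f y v = dir_deriv g y v"
proof -
  obtain B where B: "open B" "S = E \<inter> B"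
    using assms(2) by (auto simp: openin_open)
  have "((\<lambda>t::real. y + t *\<^sub>R v) \<longlongrightarrow> y + 0 *\<^sub>R v) (nhds 0)"
    by (intro tendsto_intros filterlim_ident)
  then have "\<forall>\<^sub>F t in nhds (0::real). y + t *\<^sub>R v \<in> B"
    using B assms(3) by (intro topological_tendstoD) auto
  moreover have "y + t *\<^sub>R v \<in> E" for t
    using assms(1,3,4) B by (auto simp: subspace_add subspace_scale)
  ultimately have "\<forall>\<^sub>F t in nhds (0::real). f (y + t *\<^sub>R v) = g (y + t *\<^sub>R v)"
    by (auto elim!: eventually_mono simp: assms(5) B)
  then show ?thesis
    unfolding dir_deriv_def by (intro vector_derivative_cong_eq) auto
qed

section \<open>Isomorphisms of manifolds with a 2-form\<close>

text \<open>\<open>G\<close> is meant to be the inverse of \<open>F\<close>. With both maps as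
  arguments, pulling a chart back is the same construction with \<open>F\<close> and
  \<open>G\<close> exchanged.\<close>

definition push_chart :: "('b \<Rightarrow> 'c) \<Rightarrow> ('c \<Rightarrow> 'b) \<Rightarrow> ('b, 'e) chart \<Rightarrow> ('c, 'e) chart" where
  "push_chart F G c = (F ` fst c, \<lambda>x. snd c (G x))"

lemma push_chart_sel [simp]:
  "fst (push_chart F G c) = F ` fst c" "snd (push_chart F G c) x = snd c (G x)"
  by (simp_all add: push_chart_def)

lemma homeomorphic_map_subtopology_openin_image:
  assumes "homeomorphic_maps X Y F G" "U \<subseteq> topspace X"
  shows "homeomorphic_map (subtopology Y (F ` U)) (subtopology X U) G"
proof -
  have "homeomorphic_maps (subtopology X U) (subtopology Y (F ` U)) F G"
    using assms by (intro homeomorphic_maps_subtopologies_alt)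
      (auto simp: homeomorphic_maps_def continuous_map_def subset_iff)
  then show ?thesis
    using homeomorphic_maps_map by blast
qed

text \<open>The coordinate image is unchanged, because \<open>G\<close> cancels \<open>F\<close> on
  the domain; its openness in \<open>E\<close> is therefore inherited. The new coordinate map is a
  composition of two homeomorphisms.\<close>

lemma is_chart_push_chart:
  assumes "homeomorphic_maps X Y F G" "is_chart E X c"
  shows "is_chart E Y (push_chart F G c)"
proof -
  obtain U \<phi> where c: "c = (U, \<phi>)" by fastforce
  have U: "openin X U" "openin (top_of_set E) (\<phi> ` U)"
    "homeomorphic_map (subtopology X U) (top_of_set (\<phi> ` U)) \<phi>"
    using assms(2) by (auto simp: is_chart_def c)
  have UX: "U \<subseteq> topspace X" using U(1) openin_subset by blast
  have "G (F x) = x" if "x \<in> U" for x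
    using assms(1) UX that by (auto simp: homeomorphic_maps_def)
  then have im: "(\<lambda>x. \<phi> (G x)) ` F ` U = \<phi> ` U"
    by (force simp: image_image)
  have "openin Y (F ` U)"
    using assms(1) U(1) UX homeomorphic_map_openness_eq homeomorphic_maps_map by blast
  moreover have "homeomorphic_map (subtopology Y (F ` U)) (top_of_set (\<phi> ` U)) (\<phi> \<circ> G)"
    using homeomorphic_map_compose[OF homeomorphic_map_subtopology_openin_image[OF assms(1) UX] U(3)] .
  ultimately show ?thesis
    using U(2) by (simp add: is_chart_def c push_chart_def im comp_def)
qed

lemma is_chartD:
  assumes "is_chart E T c"
  shows "fst c \<subseteq> topspace T" "openin (top_of_set E) (snd c ` fst c)" "inj_on (snd c) (fst c)"
proof -
  have *: "openin T (fst c)" "openin (top_of_set E) (snd c ` fst c)"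
    "homeomorphic_map (subtopology T (fst c)) (top_of_set (snd c ` fst c)) (snd c)"
    using assms by (simp_all add: is_chart_def case_prod_beta)
  show "fst c \<subseteq> topspace T" "openin (top_of_set E) (snd c ` fst c)"
    using * openin_subset by auto
  then show "inj_on (snd c) (fst c)"
    using homeomorphic_imp_injective_map[OF *(3)] by (simp add: inf_absorb2)
qed

lemma local_dom_eq: "local_dom c F d = snd c ` {x \<in> fst c. F x \<in> fst d}"
  and local_map_eq: "local_map c F d y = snd d (F (inv_into (fst c) (snd c) y))"
  by (simp_all add: local_dom_def local_map_def case_prod_beta)

lemma symplectic_manifoldD:
  assumes "symplectic_manifold E N" "c \<in> charts N" "x \<in> fst c" "u \<in> E" "v \<in> E"
  shows "two_form N c x u v = - two_form N c x v u"
    and "w \<in> E \<Longrightarrow> two_form N c x (u + w) v = two_form N c x u v + two_form N c x w v"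
    and "two_form N c x (a *\<^sub>R u) v = a * two_form N c x u v"
    and "\<lbrakk>d \<in> charts N; x \<in> fst d\<rbrakk> \<Longrightarrow> two_form N c x u v =
      two_form N d x (dir_deriv (local_map c id d) (snd c x) u)
        (dir_deriv (local_map c id d) (snd c x) v)"
    and "(\<And>w. w \<in> E \<Longrightarrow> two_form N c x u w = 0) \<Longrightarrow> u = 0"
    and "w \<in> E \<Longrightarrow>
      dir_deriv (\<lambda>y. two_form N c (inv_into (fst c) (snd c) y) v w) (snd c x) u +
      dir_deriv (\<lambda>y. two_form N c (inv_into (fst c) (snd c) y) w u) (snd c x) v +
      dir_deriv (\<lambda>y. two_form N c (inv_into (fst c) (snd c) y) u v) (snd c x) w = 0"
proof -
  note N = assms(1)[unfolded symplectic_manifold_def Let_def, THEN conjunct2]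
  note N1 = N[THEN conjunct1, rule_format, OF assms(2-5)]
  note N2 = N[THEN conjunct2, THEN conjunct1, rule_format, OF assms(2)]
  note N3 = N[THEN conjunct2, THEN conjunct2, THEN conjunct2]
  show "two_form N c x u v = - two_form N c x v u"
    and "w \<in> E \<Longrightarrow> two_form N c x (u + w) v = two_form N c x u v + two_form N c x w v"
    and "two_form N c x (a *\<^sub>R u) v = a * two_form N c x u v"
    using N1 by auto
  show "\<lbrakk>d \<in> charts N; x \<in> fst d\<rbrakk> \<Longrightarrow> two_form N c x u v =
      two_form N d x (dir_deriv (local_map c id d) (snd c x) u)
        (dir_deriv (local_map c id d) (snd c x) v)"
    using N2 assms(3-5) by blast
  show "(\<And>w. w \<in> E \<Longrightarrow> two_form N c x u w = 0) \<Longrightarrow> u = 0"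
    using N3[THEN conjunct1, rule_format, OF assms(2-4)] by blast
  show "w \<in> E \<Longrightarrow>
      dir_deriv (\<lambda>y. two_form N c (inv_into (fst c) (snd c) y) v w) (snd c x) u +
      dir_deriv (\<lambda>y. two_form N c (inv_into (fst c) (snd c) y) w u) (snd c x) v +
      dir_deriv (\<lambda>y. two_form N c (inv_into (fst c) (snd c) y) u v) (snd c x) w = 0"
    using N3[THEN conjunct2, rule_format, OF assms(2-5)] .
qed

text \<open>The locale is deliberately asymmetric: \<open>N\<close> is symplectic, while for
  \<open>M\<close> only topological charts that correspond to those of \<open>N\<close> are given.
  The assumption \<open>form_push\<close> puts no condition on \<open>u\<close> and
  \<open>v\<close>, so it can be applied to derivatives without checking that they lie in
  \<open>E\<close>.\<close>

locale form_iso =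
  fixes E :: "'e::euclidean_space set"
    and M :: "('b, 'e) form_manifold" and N :: "('c, 'e) form_manifold"
    and F :: "'b \<Rightarrow> 'c" and G :: "'c \<Rightarrow> 'b"
  assumes homeo: "homeomorphic_maps (base M) (base N) F G"
    and chart_M: "c \<in> charts M \<Longrightarrow> is_chart E (base M) c"
    and push: "c \<in> charts M \<Longrightarrow> push_chart F G c \<in> charts N"
    and pull: "d \<in> charts N \<Longrightarrow> push_chart G F d \<in> charts M"
    and form_push: "\<lbrakk>c \<in> charts M; x \<in> fst c\<rbrakk> \<Longrightarrow>
      two_form M c x u v = two_form N (push_chart F G c) (F x) u v"
    and symplectic_N: "symplectic_manifold E N"
begin

lemma GF: "x \<in> topspace (base M) \<Longrightarrow> G (F x) = x"
  and FG: "y \<in> topspace (base N) \<Longrightarrow> F (G y) = y"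
  and F_in: "x \<in> topspace (base M) \<Longrightarrow> F x \<in> topspace (base N)"
  and G_in: "y \<in> topspace (base N) \<Longrightarrow> G y \<in> topspace (base M)"
  using homeo by (auto simp: homeomorphic_maps_def continuous_map_def)

lemma manifold_N: "smooth_manifold E N"
  using symplectic_N by (simp add: symplectic_manifold_def)

lemma subspace_E: "subspace E"
  using manifold_N by (simp add: smooth_manifold_def)

lemma chart_subset: "c \<in> charts M \<Longrightarrow> fst c \<subseteq> topspace (base M)"
  using chart_M is_chartD(1) by blast

lemma chart_subset_N: "d \<in> charts N \<Longrightarrow> fst d \<subseteq> topspace (base N)"
  using manifold_N is_chartD(1) unfolding smooth_manifold_def by blast

lemma GF_chart: "\<lbrakk>c \<in> charts M; x \<in> fst c\<rbrakk> \<Longrightarrow> G (F x) = x"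
  by (rule GF[OF subsetD[OF chart_subset]])

lemma F_chart_iff:
  assumes "c \<in> charts M" "x \<in> topspace (base M)"
  shows "F x \<in> F ` fst c \<longleftrightarrow> x \<in> fst c"
proof
  assume "F x \<in> F ` fst c"
  then obtain x' where "x' \<in> fst c" "F x = F x'" by blast
  then show "x \<in> fst c"
    using GF[OF assms(2)] GF_chart[OF assms(1)] by metis
qed simp

lemma chart_inj: "c \<in> charts M \<Longrightarrow> inj_on (snd c) (fst c)"
  using chart_M is_chartD(3) by blast

lemma chart_open: "c \<in> charts M \<Longrightarrow> openin (top_of_set E) (snd c ` fst c)"
  using chart_M is_chartD(2) by blast

lemma push_image: "c \<in> charts M \<Longrightarrow> snd (push_chart F G c) ` F ` fst c = snd c ` fst c"
  by (force simp: image_image GF_chart)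

lemma inv_into_push:
  assumes "c \<in> charts M" "y \<in> snd c ` fst c"
  shows "inv_into (F ` fst c) (snd (push_chart F G c)) y = F (inv_into (fst c) (snd c) y)"
proof -
  have "inj_on (snd (push_chart F G c)) (F ` fst c)"
    using chart_inj[OF assms(1)] GF_chart[OF assms(1)] by (auto simp: inj_on_def)
  moreover have "inv_into (fst c) (snd c) y \<in> fst c"
    using assms(2) by (rule inv_into_into)
  ultimately show ?thesis
    using assms GF_chart by (intro inv_into_f_eq) (auto simp: f_inv_into_f)
qed

text \<open>As functions of the coordinate \<open>y\<close>, the two local representatives coincide
  on the chart image. Smoothness and closedness are conditions on these functions.\<close>

lemma form_push_inv:
  assumes "c \<in> charts M" "y \<in> snd c ` fst c"
  shows "two_form M c (inv_into (fst c) (snd c) y) u v =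
    two_form N (push_chart F G c) (inv_into (F ` fst c) (snd (push_chart F G c)) y) u v"
  using assms by (simp add: inv_into_push form_push inv_into_into)

text \<open>Read in the charts \<open>c\<close> and \<open>d\<close>, the map \<open>F\<close> is
  the coordinate change of \<open>N\<close> from the pushed chart to \<open>d\<close>. Smoothness of
  \<open>F\<close> thus becomes smoothness of a transition map of \<open>N\<close>.\<close>

lemma local_dom_push:
  assumes "c \<in> charts M"
  shows "local_dom (push_chart F G c) id d = local_dom c F d"
  using GF_chart[OF assms] by (force simp: local_dom_eq)

lemma local_map_push:
  assumes "c \<in> charts M" "y \<in> snd c ` fst c"
  shows "local_map (push_chart F G c) id d y = local_map c F d y"
  using inv_into_push[OF assms] by (simp add: local_map_eq)

lemma local_dom_subset: "local_dom c H d \<subseteq> snd c ` fst c"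
  by (auto simp: local_dom_eq)

text \<open>When the target chart is itself a pushed one, \<open>G\<close> cancels \<open>F\<close>
  and the local expression of \<open>F\<close> is a coordinate change of \<open>M\<close>. Hence the
  transition maps of \<open>M\<close> are transition maps of \<open>N\<close>.\<close>

lemma local_dom_push_target:
  assumes "c \<in> charts M" "c' \<in> charts M"
  shows "local_dom c F (push_chart F G c') = local_dom c id c'"
proof -
  have "F x \<in> F ` fst c' \<longleftrightarrow> x \<in> fst c'" if "x \<in> fst c" for x
    using F_chart_iff[OF assms(2)] chart_subset[OF assms(1)] that by blast
  then show ?thesis
    by (auto simp: local_dom_eq)
qed

lemma local_map_push_target:
  assumes "c \<in> charts M" "c' \<in> charts M" "y \<in> snd c ` fst c"
  shows "local_map c F (push_chart F G c') y = local_map c id c' y"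
  using inv_into_into[OF assms(3)] GF_chart[OF assms(1)] by (simp add: local_map_eq)

lemma smooth_local:
  assumes "c \<in> charts M" "d \<in> charts N"
  shows "smooth_on (local_dom c F d) (local_map c F d)"
proof (rule smooth_on_cong)
  show "smooth_on (local_dom (push_chart F G c) id d) (local_map (push_chart F G c) id d)"
    using manifold_N push[OF assms(1)] assms(2) by (auto simp: smooth_manifold_def)
  show "local_dom (push_chart F G c) id d = local_dom c F d"
    by (rule local_dom_push[OF assms(1)])
  fix y assume "y \<in> local_dom (push_chart F G c) id d"
  then have "y \<in> snd c ` fst c"
    using local_dom_push[OF assms(1), of d] local_dom_subset[of c F d] by simp blast
  then show "local_map (push_chart F G c) id d y = local_map c F d y"
    by (rule local_map_push[OF assms(1)])
qed

text \<open>The form is first moved to the pushed chart, where no derivative occurs, and then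
  changed to the chart \<open>d\<close> inside \<open>N\<close>, whose transition map is the local
  expression of \<open>F\<close>.\<close>

lemma form_local:
  assumes c: "c \<in> charts M" and d: "d \<in> charts N" and x: "x \<in> fst c" "F x \<in> fst d"
    and uv: "u \<in> E" "v \<in> E"
  shows "two_form M c x u v = two_form N d (F x) (dir_deriv (local_map c F d) (snd c x) u)
    (dir_deriv (local_map c F d) (snd c x) v)"
proof -
  let ?c = "push_chart F G c"
  have deriv: "dir_deriv (local_map ?c id d) (snd c x) w = dir_deriv (local_map c F d) (snd c x) w"
    if "w \<in> E" for w
    using x(1) that local_map_push[OF c, where d = d]
    by (intro dir_deriv_cong[OF subspace_E chart_open[OF c]]) simp_all
  have "two_form N ?c (F x) u v = two_form N d (F x)
      (dir_deriv (local_map ?c id d) (snd ?c (F x)) u)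
      (dir_deriv (local_map ?c id d) (snd ?c (F x)) v)"
    using x by (intro symplectic_manifoldD(4)[OF symplectic_N push[OF c] _ uv d]) auto
  then show ?thesis
    using form_push[OF c x(1)] deriv uv GF_chart[OF c x(1)] by simp
qed

lemma smooth_manifold_M: "smooth_manifold E M"
  unfolding smooth_manifold_def
proof (intro conjI ballI)
  have "base N homeomorphic_space base M"
    using homeo homeomorphic_maps_sym unfolding homeomorphic_space_def by blast
  then show "Hausdorff_space (base M)" "second_countable (base M)"
    using manifold_N homeomorphic_Hausdorff_space homeomorphic_space_second_countability
    by (auto simp: smooth_manifold_def)
  show "(\<Union>c\<in>charts M. fst c) = topspace (base M)"
  proof
    show "topspace (base M) \<subseteq> (\<Union>c\<in>charts M. fst c)"
    proof
      \<comment> \<open>A chart of \<open>N\<close> around \<open>F x\<close>, pulled back, contains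
        \<open>x\<close>; this is where \<open>pull\<close> enters.\<close>
      fix x assume x: "x \<in> topspace (base M)"
      have "(\<Union>d\<in>charts N. fst d) = topspace (base N)"
        using manifold_N by (simp add: smooth_manifold_def)
      then obtain d where d: "d \<in> charts N" "F x \<in> fst d"
        using F_in[OF x] by blast
      then have "x \<in> fst (push_chart G F d)"
        using GF[OF x] imageI[OF d(2), of G] by simp
      then show "x \<in> (\<Union>c\<in>charts M. fst c)"
        using pull[OF d(1)] by blast
    qed
  qed (use chart_subset in blast)
next
  fix c c' assume c: "c \<in> charts M" "c' \<in> charts M"
  show "smooth_on (local_dom c id c') (local_map c id c')"
  proof (rule smooth_on_cong[OF smooth_local[OF c(1) push[OF c(2)]]])
    show "local_dom c F (push_chart F G c') = local_dom c id c'"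
      by (rule local_dom_push_target[OF c])
    show "local_map c F (push_chart F G c') y = local_map c id c' y"
      if "y \<in> local_dom c F (push_chart F G c')" for y
      using local_map_push_target[OF c subsetD[OF local_dom_subset that]] .
  qed
qed (use subspace_E chart_M in auto)

theorem symplectic_manifold_M: "symplectic_manifold E M"
  unfolding symplectic_manifold_def
proof (intro conjI ballI allI impI smooth_manifold_M)
  fix c x u v assume c: "c \<in> charts M" "x \<in> fst c" and uv: "u \<in> E" "v \<in> E"
  have "F x \<in> fst (push_chart F G c)" using c by simp
  note N = symplectic_manifoldD[OF symplectic_N push[OF c(1)] this uv, folded form_push[OF c]]
  show "two_form M c x u v = - two_form M c x v u"
    by (rule N(1))
  show "two_form M c x (u + w) v = two_form M c x u v + two_form M c x w v" if "w \<in> E" for w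
    using that by (rule N(2))
  show "two_form M c x (a *\<^sub>R u) v = a * two_form M c x u v" for a
    by (rule N(3))
next
  fix c c' x u v
  assume c: "c \<in> charts M" "c' \<in> charts M" and x: "x \<in> fst c \<inter> fst c'" and uv: "u \<in> E" "v \<in> E"
  have deriv: "dir_deriv (local_map c F (push_chart F G c')) (snd c x) w =
      dir_deriv (local_map c id c') (snd c x) w" if "w \<in> E" for w
    using x that
    by (intro dir_deriv_cong[OF subspace_E chart_open[OF c(1)]]) (simp_all add: local_map_push_target c)
  \<comment> \<open>A detour through \<open>N\<close>: \<open>form_local\<close> with the pushed
    \<open>c'\<close> as target, then \<open>form_push\<close> for \<open>c'\<close> read
    backwards.\<close>
  show "two_form M c x u v = two_form M c' x (dir_deriv (local_map c id c') (snd c x) u)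
      (dir_deriv (local_map c id c') (snd c x) v)"
    using form_local[OF c(1) push[OF c(2)], of x u v] x uv deriv form_push[OF c(2), of x] by simp
next
  fix c u v assume c: "c \<in> charts M" "u \<in> E" "v \<in> E"
  let ?c = "push_chart F G c"
  have "smooth_on (snd ?c ` fst ?c) (\<lambda>y. two_form N ?c (inv_into (fst ?c) (snd ?c) y) u v)"
    using symplectic_N push[OF c(1)] c(2,3) unfolding symplectic_manifold_def by blast
  then show "smooth_on (snd c ` fst c) (\<lambda>y. two_form M c (inv_into (fst c) (snd c) y) u v)"
  proof (rule smooth_on_cong)
    show im: "snd ?c ` fst ?c = snd c ` fst c"
      using push_image[OF c(1)] by simp
    show "two_form N ?c (inv_into (fst ?c) (snd ?c) y) u v =
        two_form M c (inv_into (fst c) (snd c) y) u v" if "y \<in> snd ?c ` fst ?c" for y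
      using form_push_inv[OF c(1)] that unfolding im by simp
  qed
next
  fix c x u assume c: "c \<in> charts M" "x \<in> fst c" "u \<in> E" and *: "\<forall>v\<in>E. two_form M c x u v = 0"
  have "F x \<in> fst (push_chart F G c)" using c by simp
  then show "u = 0"
    using symplectic_manifoldD(5)[OF symplectic_N push[OF c(1)] _ c(3,3)] * form_push[OF c(1,2)]
    by auto
next
  fix c x u v w assume c: "c \<in> charts M" "x \<in> fst c" "u \<in> E" "v \<in> E" "w \<in> E"
  let ?c = "push_chart F G c"
  let ?M = "\<lambda>u v y. two_form M c (inv_into (fst c) (snd c) y) u v"
  let ?N = "\<lambda>u v y. two_form N ?c (inv_into (fst ?c) (snd ?c) y) u v"
  have deriv: "dir_deriv (?M a b) (snd c x) e = dir_deriv (?N a b) (snd c x) e" if "e \<in> E" for a b e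
    using c(2) that form_push_inv[OF c(1)]
    by (intro dir_deriv_cong[OF subspace_E chart_open[OF c(1)]]) simp_all
  have "F x \<in> fst ?c" using c by simp
  then have "dir_deriv (?N v w) (snd ?c (F x)) u + dir_deriv (?N w u) (snd ?c (F x)) v +
      dir_deriv (?N u v) (snd ?c (F x)) w = 0"
    by (rule symplectic_manifoldD(6)[OF symplectic_N push[OF c(1)] _ c(3-5)])
  then show "let \<Omega> = ?M; y = snd c x
      in dir_deriv (\<Omega> v w) y u + dir_deriv (\<Omega> w u) y v + dir_deriv (\<Omega> u v) y w = 0"
    using deriv c(3-5) GF_chart[OF c(1,2)] by (simp add: Let_def)
qed

theorem symplectomorphism_F: "symplectomorphism E M N F"
proof -
  let ?I = "inv_into (topspace (base M)) F"
  have bij: "bij_betw F (topspace (base M)) (topspace (base N))"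
    by (rule bij_betw_byWitness[where f' = G]) (use GF FG F_in G_in in auto)
  \<comment> \<open>\<open>symplectomorphism\<close> speaks of the inverse as
    \<open>inv_into\<close>; on the points of \<open>N\<close> it is \<open>G\<close>.\<close>
  have I: "?I y = G y" if "y \<in> topspace (base N)" for y
    using that bij FG G_in by (intro inv_into_f_eq) (auto simp: bij_betw_def)
  have "smooth_map N M ?I"
    unfolding smooth_map_def
  proof (intro conjI ballI)
    show "continuous_map (base N) (base M) ?I"
      using homeo I by (auto simp: homeomorphic_maps_def intro: continuous_map_eq)
    fix d c assume dc: "d \<in> charts N" "c \<in> charts M"
    \<comment> \<open>In the charts \<open>d\<close> and \<open>c\<close> the inverse map is the
      coordinate change of \<open>N\<close> from \<open>d\<close> to the pushed
      \<open>c\<close>.\<close>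
    have "smooth_on (local_dom d id (push_chart F G c)) (local_map d id (push_chart F G c))"
      using manifold_N dc push by (auto simp: smooth_manifold_def)
    then show "smooth_on (local_dom d ?I c) (local_map d ?I c)"
    proof (rule smooth_on_cong)
      have "G y \<in> fst c \<longleftrightarrow> y \<in> F ` fst c" if "y \<in> topspace (base N)" for y
        using that F_chart_iff[OF dc(2) G_in] FG by simp
      then show "local_dom d id (push_chart F G c) = local_dom d ?I c"
        using chart_subset_N[OF dc(1)] I
        by (force simp: local_dom_eq)
      fix y assume "y \<in> local_dom d id (push_chart F G c)"
      then have "inv_into (fst d) (snd d) y \<in> topspace (base N)"
        using local_dom_subset chart_subset_N[OF dc(1)] by (meson inv_into_into subsetD)
      then show "local_map d id (push_chart F G c) y = local_map d ?I c y"
        using I by (simp add: local_map_eq)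
    qed
  qed
  moreover have "smooth_map M N F"
    using homeo smooth_local by (auto simp: smooth_map_def homeomorphic_maps_def)
  ultimately show ?thesis
    using bij form_local by (auto simp: symplectomorphism_def)
qed

end

section \<open>Naturality of symplectic reduction\<close>

text \<open>By \<open>coord_f\<close> corresponding points sit at the same place of
  \<open>'w\<close>, so tangent vectors are literally equal and \<open>omega_f\<close> can compare
  the forms without a differential. The points are not assumed to be closed under the action, so
  equivariance of \<open>g\<close> is an assumption of its own.\<close>

locale ham_iso =
  fixes H :: "('a, 'w::euclidean_space) ham_space" and H' :: "('b, 'w) ham_space"
    and f :: "'a \<Rightarrow> 'b" and g :: "'b \<Rightarrow> 'a"
  assumes f_in: "p \<in> points H \<Longrightarrow> f p \<in> points H'"
    and g_in: "q \<in> points H' \<Longrightarrow> g q \<in> points H"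
    and gf: "p \<in> points H \<Longrightarrow> g (f p) = p"
    and fg: "q \<in> points H' \<Longrightarrow> f (g q) = q"
    and coord_f: "p \<in> points H \<Longrightarrow> coord H' (f p) = coord H p"
    and inj_coord: "inj_on (coord H) (points H)"
    and act_f: "\<lbrakk>k \<in> SU3; p \<in> points H\<rbrakk> \<Longrightarrow> f (act H k p) = act H' k (f p)"
    and act_g: "\<lbrakk>k \<in> SU3; q \<in> points H'\<rbrakk> \<Longrightarrow> g (act H' k q) = act H k (g q)"
    and omega_f: "p \<in> points H \<Longrightarrow> omega H' (f p) = omega H p"
    and moment_f: "p \<in> points H \<Longrightarrow> moment H' (f p) = moment H p"
begin

lemma ham_iso_sym: "ham_iso H' H g f"
proof
  fix q assume q: "q \<in> points H'"
  show "coord H (g q) = coord H' q" "omega H (g q) = omega H' q" "moment H (g q) = moment H' q"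
    using coord_f[OF g_in[OF q]] omega_f[OF g_in[OF q]] moment_f[OF g_in[OF q]] fg[OF q]
    by simp_all
next
  show "inj_on (coord H') (points H')"
  proof (rule inj_onI)
    fix q r assume qr: "q \<in> points H'" "r \<in> points H'" "coord H' q = coord H' r"
    then have "coord H (g q) = coord H (g r)"
      using coord_f[OF g_in[OF qr(1)]] coord_f[OF g_in[OF qr(2)]] fg by simp
    then have "g q = g r"
      using inj_onD[OF inj_coord] g_in qr by blast
    then show "q = r"
      using fg qr by metis
  qed
qed (simp_all add: f_in g_in gf fg act_f act_g)

lemma zero_points: "p \<in> zero_level H \<Longrightarrow> p \<in> points H"
  and zero_points': "q \<in> zero_level H' \<Longrightarrow> q \<in> points H'"
  by (simp_all add: zero_level_def)

lemma zero_f: "p \<in> zero_level H \<Longrightarrow> f p \<in> zero_level H'"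
  by (simp add: zero_level_def f_in moment_f)

lemma zero_g: "q \<in> zero_level H' \<Longrightarrow> g q \<in> zero_level H"
  by (rule ham_iso.zero_f[OF ham_iso_sym])

lemma orbit_f: "p \<in> zero_level H \<Longrightarrow> f ` orbit_of H p = orbit_of H' (f p)"
  by (simp add: orbit_of_def image_image act_f zero_points)

text \<open>Elements of an orbit are not known to be points, so \<open>g\<close> and
  \<open>f\<close> cannot be cancelled elementwise; equivariance of \<open>g\<close> reduces the
  claim to cancellation at \<open>p\<close>.\<close>

lemma orbit_gf: "p \<in> zero_level H \<Longrightarrow> g ` orbit_of H' (f p) = orbit_of H p"
  by (metis ham_iso.orbit_f ham_iso_sym gf zero_f zero_points)

lemma image_gf: "x \<in> orbit_of H ` zero_level H \<Longrightarrow> g ` f ` x = x"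
  by (metis imageE orbit_f orbit_gf)

text \<open>An open set of the target is cut out upstairs by an open set \<open>B\<close> of the
  ambient space. Since \<open>f\<close> preserves coordinates, the same \<open>B\<close> cuts out
  the preimage.\<close>

lemma continuous_map_quotient:
  "continuous_map (quotient_topology H) (quotient_topology H') ((`) f)"
  unfolding continuous_map_def topspace_quotient_topology
proof (intro conjI allI impI)
  show "(`) f \<in> orbit_of H ` zero_level H \<rightarrow> orbit_of H' ` zero_level H'"
    using orbit_f zero_f by auto
  fix V assume "openin (quotient_topology H') V"
  then obtain B where B: "open B"
      "{q \<in> zero_level H'. orbit_of H' q \<in> V} = coord H' -` B \<inter> zero_level H'"
    by (auto simp: openin_quotient_topology openin_pullback_topology)
  have "coord H p \<in> B \<longleftrightarrow> orbit_of H' (f p) \<in> V" if "p \<in> zero_level H" for p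
    using B(2)[THEN eqset_imp_iff, of "f p"] zero_f[OF that] coord_f[OF zero_points[OF that]] by simp
  then have "{p \<in> zero_level H. orbit_of H p \<in> {x \<in> orbit_of H ` zero_level H. f ` x \<in> V}} =
      coord H -` B \<inter> zero_level H"
    using orbit_f by auto
  then show "openin (quotient_topology H) {x \<in> orbit_of H ` zero_level H. f ` x \<in> V}"
    using B(1) by (auto simp: openin_quotient_topology openin_pullback_topology)
qed

lemma homeomorphic_quotient:
  "homeomorphic_maps (quotient_topology H) (quotient_topology H') ((`) f) ((`) g)"
  unfolding homeomorphic_maps_def topspace_quotient_topology
  using continuous_map_quotient ham_iso.continuous_map_quotient[OF ham_iso_sym]
    ham_iso.orbit_gf[OF ham_iso_sym]
  by (auto simp: orbit_f orbit_gf ham_iso.orbit_f[OF ham_iso_sym])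

text \<open>The curve is controlled only for small times, where it stays in the zero level;
  derivatives at \<open>0\<close> depend on nothing else.\<close>

lemma curve_f:
  assumes "curve_at H p \<gamma>"
  shows "curve_at H' (f p) (\<lambda>t. f (\<gamma> t))"
    and "velocity H' (\<lambda>t. f (\<gamma> t)) = velocity H \<gamma>"
    and "(\<And>x. x \<in> orbit_of H ` zero_level H \<Longrightarrow> snd c' (f ` x) = snd c x) \<Longrightarrow>
      projected_velocity H' c' (\<lambda>t. f (\<gamma> t)) = projected_velocity H c \<gamma>"
proof -
  obtain \<epsilon> where \<epsilon>: "\<epsilon> > 0" "\<gamma> 0 = p" "\<gamma> ` {-\<epsilon><..<\<epsilon>} \<subseteq> zero_level H"
      "smooth_on {-\<epsilon><..<\<epsilon>} (\<lambda>t. coord H (\<gamma> t))"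
    using assms by (auto simp: curve_at_def)
  have Z: "\<gamma> t \<in> zero_level H" if "t \<in> {-\<epsilon><..<\<epsilon>}" for t
    using \<epsilon>(3) that by blast
  have ev: "\<forall>\<^sub>F t in nhds 0. t \<in> {-\<epsilon><..<\<epsilon>}"
    using \<epsilon>(1) by (intro eventually_nhds_in_open) auto
  have co: "coord H' (f (\<gamma> t)) = coord H (\<gamma> t)" if "t \<in> {-\<epsilon><..<\<epsilon>}" for t
    using coord_f zero_points Z[OF that] by blast
  have "smooth_on {-\<epsilon><..<\<epsilon>} (\<lambda>t. coord H' (f (\<gamma> t)))"
    using \<epsilon>(4) by (rule smooth_on_cong) (simp_all add: co)
  then show "curve_at H' (f p) (\<lambda>t. f (\<gamma> t))"
    using \<epsilon>(1,2) Z zero_f unfolding curve_at_def by blast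
  show "velocity H' (\<lambda>t. f (\<gamma> t)) = velocity H \<gamma>"
    unfolding velocity_def using ev co
    by (intro vector_derivative_cong_eq) (auto elim: eventually_mono)
  assume "\<And>x. x \<in> orbit_of H ` zero_level H \<Longrightarrow> snd c' (f ` x) = snd c x"
  then have "snd c' (orbit_of H' (f (\<gamma> t))) = snd c (orbit_of H (\<gamma> t))" if "t \<in> {-\<epsilon><..<\<epsilon>}" for t
    using orbit_f Z[OF that] by (metis imageI)
  then show "projected_velocity H' c' (\<lambda>t. f (\<gamma> t)) = projected_velocity H c \<gamma>"
    unfolding projected_velocity_def using ev
    by (intro vector_derivative_cong_eq) (auto elim: eventually_mono)
qed

lemma projected_velocity_push:
  assumes "curve_at H p \<gamma>"
  shows "projected_velocity H' (push_chart ((`) f) ((`) g) c) (\<lambda>t. f (\<gamma> t)) =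
    projected_velocity H c \<gamma>"
  by (rule curve_f(3)[OF assms]) (auto simp: orbit_f orbit_gf)

text \<open>The charts are only required to agree on orbits so that the lemma also serves the way
  back: pushing forward and back again returns \<open>c\<close> only on orbits of the zero
  level.\<close>

lemma form_witness_f:
  assumes agree: "\<And>x. x \<in> orbit_of H ` zero_level H \<Longrightarrow> snd c' (f ` x) = snd c x"
    and ex: "\<exists>p \<gamma> \<delta>. p \<in> zero_level H \<and> orbit_of H p = x \<and> curve_at H p \<gamma> \<and> curve_at H p \<delta> \<and>
      projected_velocity H c \<gamma> = u \<and> projected_velocity H c \<delta> = v \<and>
      r = omega H p (velocity H \<gamma>) (velocity H \<delta>)"
  shows "\<exists>p \<gamma> \<delta>. p \<in> zero_level H' \<and> orbit_of H' p = f ` x \<and>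
      curve_at H' p \<gamma> \<and> curve_at H' p \<delta> \<and>
      projected_velocity H' c' \<gamma> = u \<and> projected_velocity H' c' \<delta> = v \<and>
      r = omega H' p (velocity H' \<gamma>) (velocity H' \<delta>)"
proof -
  obtain p \<gamma> \<delta> where p: "p \<in> zero_level H" "orbit_of H p = x"
    and \<gamma>: "curve_at H p \<gamma>" "projected_velocity H c \<gamma> = u"
    and \<delta>: "curve_at H p \<delta>" "projected_velocity H c \<delta> = v"
    and r: "r = omega H p (velocity H \<gamma>) (velocity H \<delta>)"
    using ex by blast
  show ?thesis
  proof (intro exI conjI)
    show "f p \<in> zero_level H'" "orbit_of H' (f p) = f ` x"
      using p zero_f orbit_f by auto
    show "curve_at H' (f p) (\<lambda>t. f (\<gamma> t))" "curve_at H' (f p) (\<lambda>t. f (\<delta> t))"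
      using curve_f(1) \<gamma>(1) \<delta>(1) by auto
    show "projected_velocity H' c' (\<lambda>t. f (\<gamma> t)) = u" "projected_velocity H' c' (\<lambda>t. f (\<delta> t)) = v"
      using curve_f(3)[OF \<gamma>(1) agree] curve_f(3)[OF \<delta>(1) agree] \<gamma>(2) \<delta>(2) by simp_all
    show "r = omega H' (f p) (velocity H' (\<lambda>t. f (\<gamma> t))) (velocity H' (\<lambda>t. f (\<delta> t)))"
      using r omega_f[OF zero_points[OF p(1)]] curve_f(2)[OF \<gamma>(1)] curve_f(2)[OF \<delta>(1)] by simp
  qed
qed

text \<open>The predicates under the two definite descriptions are equivalent, so the values agree
  without any appeal to existence or uniqueness.\<close>

lemma reduced_form_f:
  assumes x: "x \<in> orbit_of H ` zero_level H"
  shows "reduced_form H c x u v = reduced_form H' (push_chart ((`) f) ((`) g) c) (f ` x) u v"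
  unfolding reduced_form_def
proof (intro arg_cong[of _ _ The] ext iffI)
  fix r
  show "\<exists>p \<gamma> \<delta>. p \<in> zero_level H' \<and> orbit_of H' p = f ` x \<and> curve_at H' p \<gamma> \<and> curve_at H' p \<delta> \<and>
      projected_velocity H' (push_chart ((`) f) ((`) g) c) \<gamma> = u \<and>
      projected_velocity H' (push_chart ((`) f) ((`) g) c) \<delta> = v \<and>
      r = omega H' p (velocity H' \<gamma>) (velocity H' \<delta>)"
    if "\<exists>p \<gamma> \<delta>. p \<in> zero_level H \<and> orbit_of H p = x \<and> curve_at H p \<gamma> \<and> curve_at H p \<delta> \<and>
      projected_velocity H c \<gamma> = u \<and> projected_velocity H c \<delta> = v \<and>
      r = omega H p (velocity H \<gamma>) (velocity H \<delta>)"
    by (rule form_witness_f[OF _ that]) (auto simp: orbit_f orbit_gf)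
  show "\<exists>p \<gamma> \<delta>. p \<in> zero_level H \<and> orbit_of H p = x \<and> curve_at H p \<gamma> \<and> curve_at H p \<delta> \<and>
      projected_velocity H c \<gamma> = u \<and> projected_velocity H c \<delta> = v \<and>
      r = omega H p (velocity H \<gamma>) (velocity H \<delta>)"
    if "\<exists>p \<gamma> \<delta>. p \<in> zero_level H' \<and> orbit_of H' p = f ` x \<and> curve_at H' p \<gamma> \<and> curve_at H' p \<delta> \<and>
      projected_velocity H' (push_chart ((`) f) ((`) g) c) \<gamma> = u \<and>
      projected_velocity H' (push_chart ((`) f) ((`) g) c) \<delta> = v \<and>
      r = omega H' p (velocity H' \<gamma>) (velocity H' \<delta>)"
    using ham_iso.form_witness_f[OF ham_iso_sym _ that, of c] by (simp add: image_gf[OF x])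
qed

lemma push_quotient_chart:
  assumes c: "c \<in> quotient_charts E H"
  shows "push_chart ((`) f) ((`) g) c \<in> quotient_charts E H'"
proof -
  obtain U \<phi> where c_eq: "c = (U, \<phi>)" by fastforce
  let ?\<psi> = "\<lambda>x. \<phi> (g ` x)"
  let ?N = "{p \<in> zero_level H. orbit_of H p \<in> U}"
  let ?N' = "{q \<in> zero_level H'. orbit_of H' q \<in> (`) f ` U}"
  have chart: "is_chart E (quotient_topology H) (U, \<phi>)"
    and smooth: "smooth_on (coord H ` ?N) (\<lambda>w. \<phi> (orbit_of H (inv_into ?N (coord H) w)))"
    and local_section: "\<And>p. p \<in> ?N \<Longrightarrow> \<exists>V s. openin (top_of_set E) V \<and> \<phi> (orbit_of H p) \<in> V \<and>
            s ` V \<subseteq> ?N \<and> smooth_on V (\<lambda>y. coord H (s y)) \<and>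
            s (\<phi> (orbit_of H p)) = p \<and> (\<forall>y\<in>V. \<phi> (orbit_of H (s y)) = y)"
    using c by (auto simp: quotient_charts_def c_eq Let_def)
  have U: "U \<subseteq> orbit_of H ` zero_level H"
    using is_chartD(1)[OF chart] by (simp add: topspace_quotient_topology)
  have N_iff: "f p \<in> ?N' \<longleftrightarrow> p \<in> ?N" if p: "p \<in> zero_level H" for p
  proof -
    \<comment> \<open>Taking images under \<open>f\<close> is injective on orbits of the zero level,
      since taking images under \<open>g\<close> undoes it there.\<close>
    have "orbit_of H p \<in> U" if "f ` orbit_of H p = f ` x" "x \<in> U" for x
    proof -
      have "g ` f ` x = x"
        using image_gf that(2) U by blast
      moreover have "g ` f ` orbit_of H p = orbit_of H p"
        using p orbit_f orbit_gf by simp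
      ultimately show ?thesis
        using that by metis
    qed
    then show ?thesis
      using p zero_f[OF p] orbit_f[OF p, symmetric] by auto
  qed
  have N': "?N' = f ` ?N"
  proof (intro equalityI subsetI)
    fix q assume q: "q \<in> ?N'"
    then have "g q \<in> zero_level H" "f (g q) = q"
      using zero_g fg zero_points' by auto
    with q N_iff[of "g q"] show "q \<in> f ` ?N"
      by (metis (no_types, lifting) imageI)
  qed (use N_iff in blast)
  have coord_N: "coord H' (f p) = coord H p" if "p \<in> ?N" for p
    using that coord_f zero_points by simp
  have psi: "?\<psi> (orbit_of H' (f p)) = \<phi> (orbit_of H p)" if "p \<in> ?N" for p
    using that orbit_gf by simp
  have inj: "inj_on (coord H) ?N" "inj_on (coord H') ?N'"
    using inj_coord ham_iso.inj_coord[OF ham_iso_sym] zero_points zero_points'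
    by (auto intro: inj_on_subset)
  have "smooth_on (coord H' ` ?N') (\<lambda>w. ?\<psi> (orbit_of H' (inv_into ?N' (coord H') w)))"
    using smooth
  proof (rule smooth_on_cong)
    show "coord H ` ?N = coord H' ` ?N'"
      unfolding N' image_image by (rule image_cong[OF refl coord_N[symmetric]])
    fix w assume "w \<in> coord H ` ?N"
    then obtain p where p: "p \<in> ?N" "w = coord H p" by blast
    \<comment> \<open>\<open>p\<close> and \<open>f p\<close> share the coordinate \<open>w\<close>,
      and injectivity of the coordinates makes \<open>inv_into\<close> select exactly them.\<close>
    have "inv_into ?N (coord H) w = p"
      using p inj(1) by (simp add: inv_into_f_f)
    moreover have "inv_into ?N' (coord H') w = f p"
      using p coord_N N' by (intro inv_into_f_eq[OF inj(2)]) blast+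
    ultimately show "\<phi> (orbit_of H (inv_into ?N (coord H) w)) =
        ?\<psi> (orbit_of H' (inv_into ?N' (coord H') w))"
      using psi[OF p(1)] by simp
  qed
  moreover have "\<exists>V s. openin (top_of_set E) V \<and> ?\<psi> (orbit_of H' q) \<in> V \<and>
      s ` V \<subseteq> ?N' \<and> smooth_on V (\<lambda>y. coord H' (s y)) \<and>
      s (?\<psi> (orbit_of H' q)) = q \<and> (\<forall>y\<in>V. ?\<psi> (orbit_of H' (s y)) = y)" if q: "q \<in> ?N'" for q
  proof -
    obtain p where p: "p \<in> ?N" "q = f p"
      using q[unfolded N'] by (elim imageE)
    obtain V s where V: "openin (top_of_set E) V" "\<phi> (orbit_of H p) \<in> V"
      and s: "s ` V \<subseteq> ?N" "smooth_on V (\<lambda>y. coord H (s y))" "s (\<phi> (orbit_of H p)) = p"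
        "\<forall>y\<in>V. \<phi> (orbit_of H (s y)) = y"
      using local_section[OF p(1)] by (elim exE conjE)
    have sN: "s y \<in> ?N" if "y \<in> V" for y
      using s(1) that by blast
    \<comment> \<open>The section for the pushed chart is \<open>f\<close> after \<open>s\<close>;
      in Euclidean coordinates it is the same map.\<close>
    have "smooth_on V (\<lambda>y. coord H' (f (s y)))"
      using s(2) refl by (rule smooth_on_cong) (simp add: coord_N[OF sN])
    moreover have "(\<lambda>y. f (s y)) ` V \<subseteq> ?N'"
      unfolding N' using sN by blast
    moreover have "\<forall>y\<in>V. ?\<psi> (orbit_of H' (f (s y))) = y"
      using s(4) psi[OF sN] by metis
    ultimately show ?thesis
      using V s(3) unfolding p(2) psi[OF p(1)]
      by (intro exI[of _ V] exI[of _ "\<lambda>y. f (s y)"] conjI) (simp_all only:)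
  qed
  moreover have "is_chart E (quotient_topology H') ((`) f ` U, ?\<psi>)"
    using is_chart_push_chart[OF homeomorphic_quotient chart] by (simp add: push_chart_def)
  ultimately show ?thesis
    by (simp add: quotient_charts_def c_eq push_chart_def Let_def)
qed

lemma form_iso_quotient:
  assumes "symplectic_manifold E (symplectic_quotient E H')"
  shows "form_iso E (symplectic_quotient E H) (symplectic_quotient E H') ((`) f) ((`) g)"
proof
  show "homeomorphic_maps (base (symplectic_quotient E H)) (base (symplectic_quotient E H'))
      ((`) f) ((`) g)"
    using homeomorphic_quotient by (simp add: symplectic_quotient_def)
  show chart: "is_chart E (base (symplectic_quotient E H)) c"
    if "c \<in> charts (symplectic_quotient E H)" for c
    using that by (auto simp: symplectic_quotient_def quotient_charts_def)
  show "push_chart ((`) f) ((`) g) c \<in> charts (symplectic_quotient E H')"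
    if "c \<in> charts (symplectic_quotient E H)" for c
    using that push_quotient_chart by (simp add: symplectic_quotient_def)
  show "push_chart ((`) g) ((`) f) d \<in> charts (symplectic_quotient E H)"
    if "d \<in> charts (symplectic_quotient E H')" for d
    using that ham_iso.push_quotient_chart[OF ham_iso_sym] by (simp add: symplectic_quotient_def)
  show "two_form (symplectic_quotient E H) c x u v =
      two_form (symplectic_quotient E H') (push_chart ((`) f) ((`) g) c) (f ` x) u v"
    if "c \<in> charts (symplectic_quotient E H)" "x \<in> fst c" for c x u v
  proof -
    have "x \<in> orbit_of H ` zero_level H"
      using is_chartD(1)[OF chart[OF that(1)]] that(2)
      by (auto simp: symplectic_quotient_def topspace_quotient_topology)
    then show ?thesis
      using reduced_form_f by (simp add: symplectic_quotient_def)
  qed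
qed (rule assms)

theorem symplectic_quotient_iso:
  assumes "quotient_is_symplectic_manifold E H'"
  shows "quotient_is_symplectic_manifold E H"
    and "symplectomorphism E (symplectic_quotient E H) (symplectic_quotient E H') ((`) f)"
proof -
  have "symplectic_manifold E (symplectic_quotient E H')"
    using assms by (simp add: quotient_is_symplectic_manifold_def)
  note iso = form_iso_quotient[OF this]
  show "symplectomorphism E (symplectic_quotient E H) (symplectic_quotient E H') ((`) f)"
    using form_iso.symplectomorphism_F[OF iso] .
  show "quotient_is_symplectic_manifold E H"
    unfolding quotient_is_symplectic_manifold_def
  proof (intro conjI ballI allI impI)
    show "symplectic_manifold E (symplectic_quotient E H)"
      using form_iso.symplectic_manifold_M[OF iso] .
    fix c p \<gamma> \<delta>
    assume c: "c \<in> quotient_charts E H" and p: "p \<in> zero_level H" "orbit_of H p \<in> fst c"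
      and "curve_at H p \<gamma> \<and> curve_at H p \<delta>"
    then have \<gamma>: "curve_at H p \<gamma>" and \<delta>: "curve_at H p \<delta>" by auto
    let ?c = "push_chart ((`) f) ((`) g) c"
    have "orbit_of H' (f p) \<in> fst ?c"
      using p orbit_f[OF p(1), symmetric] by simp
    \<comment> \<open>The pullback identity for \<open>H'\<close> is taken at the image curves in
      the pushed chart; each of its terms equals the corresponding term for
      \<open>H\<close>.\<close>
    then have "reduced_form H' ?c (orbit_of H' (f p)) (projected_velocity H' ?c (\<lambda>t. f (\<gamma> t)))
        (projected_velocity H' ?c (\<lambda>t. f (\<delta> t))) =
      omega H' (f p) (velocity H' (\<lambda>t. f (\<gamma> t))) (velocity H' (\<lambda>t. f (\<delta> t)))"
      using assms push_quotient_chart[OF c] zero_f[OF p(1)] curve_f(1)[OF \<gamma>] curve_f(1)[OF \<delta>]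
      unfolding quotient_is_symplectic_manifold_def by blast
    then show "reduced_form H c (orbit_of H p) (projected_velocity H c \<gamma>) (projected_velocity H c \<delta>) =
        omega H p (velocity H \<gamma>) (velocity H \<delta>)"
      unfolding projected_velocity_push[OF \<gamma>] projected_velocity_push[OF \<delta>]
        curve_f(2)[OF \<gamma>] curve_f(2)[OF \<delta>] omega_f[OF zero_points[OF p(1)]]
        orbit_f[OF p(1), symmetric] reduced_form_f[OF imageI[OF p(1)], symmetric] .
  qed
qed

end

section \<open>Higgs fields and their residues\<close>

text \<open>The field is a combination of its residues with scalar coefficients, which commute with
  constant matrices. The identities hold at the poles too, where division by zero gives zero on both
  sides; equality of Higgs fields as functions relies on this.\<close>

lemma matrix_mult_higgs_field:
  "A ** higgs_field (X, Y, Z) z = higgs_field (A ** X, A ** Y, A ** Z) z"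
  "higgs_field (X, Y, Z) z ** A = higgs_field (X ** A, Y ** A, Z ** A) z"
  by (simp_all add: vec_eq_iff higgs_field_def matrix_matrix_mult_def sum.distrib
      distrib_left distrib_right sum_divide_distrib)

lemma Ad_higgs_field: "Ad g (higgs_field t z) = higgs_field (Ad_triple g t) z"
  by (cases t) (simp add: Ad_def Ad_triple_def matrix_mult_higgs_field)

lemma higgs_act: "(\<lambda>z. Ad g (higgs_field t z)) = higgs_field (Ad_triple g t)"
  by (rule ext) (rule Ad_higgs_field)

text \<open>The Higgs side is the source because the symplectic assumption concerns the triples. Its
  points are by definition values of \<open>higgs_field\<close>, so
  \<open>residues_higgs_field\<close> yields both inverse laws.\<close>

lemma ham_iso_higgs_triple:
  "ham_iso (higgs_space ip lam mu nu) (triple_space ip lam mu nu) residues higgs_field"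
proof -
  have "inj_on residues (higgs_field ` orbit_product lam mu nu)"
    by (rule inj_on_inverseI[where g = higgs_field]) (auto simp: residues_higgs_field)
  then show ?thesis
    unfolding ham_iso_def higgs_space_def triple_space_def
    by (simp add: ball_simps image_iff residues_higgs_field higgs_act)
      (auto simp: residues_higgs_field higgs_act)
qed

lemma residue_map_conj_class: "residue_map (conj_class (higgs_field t)) = triple_class t"
  by (simp add: residue_map_def conj_class_def triple_class_def image_image higgs_act
      residues_higgs_field)

theorem mainTheorem1:
  fixes lam mu nu :: "real^3^3"
    and ip :: "mat3 \<Rightarrow> mat3 \<Rightarrow> real"
    and E :: "'e::euclidean_space set"
  assumes "diagonal_traceless lam" "diagonal_traceless mu" "diagonal_traceless nu"
    and "invariant_inner_product ip"
    and "quotient_is_symplectic_manifold E (triple_space ip lam mu nu)"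
  shows "quotient_is_symplectic_manifold E (higgs_space ip lam mu nu) \<and>
    (\<forall>X\<in>adj_orbit (imat lam). \<forall>Y\<in>adj_orbit (imat mu). \<forall>Z\<in>adj_orbit (imat nu).
       X + Y + Z = 0 \<longrightarrow>
       residue_map (conj_class (higgs_field (X, Y, Z))) = triple_class (X, Y, Z)) \<and>
    symplectomorphism E (higgs_moduli E ip lam mu nu) (triple_reduced_product E ip lam mu nu)
      residue_map"
proof -
  have "residue_map = (`) residues"
    by (simp add: residue_map_def fun_eq_iff)
  then show ?thesis
    using ham_iso.symplectic_quotient_iso[OF ham_iso_higgs_triple assms(5)]
    by (simp add: residue_map_conj_class higgs_moduli_def triple_reduced_product_def)
qed

end
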